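(* Let $d$ be a metric on a nontrivial real vector space $X$, let $f(x):=d(x,0_X)$ for $x\in X$, let $\sigma\in[1,\infty)$, and let $$H^\sigma_d(x,y,t):=\frac{f^\sigma(x+ty)+f^\sigma(x-ty)}{2^{\sigma-1}(1+t^\sigma)}\quad\text{for all } x,y\in X,\ t\in[0,1].$$ If $f$ is absolutely homogeneous, then \begin{align*} C_{\mathrm{NJ}}^{(\sigma)}(d)&=\sup_{f(x)=f(y)=1,\;t\in[0,1]}H^\sigma_d(x,y,t) =\sup_{f(x)=1,\;f(y)\le1,\;t\in[0,1]}H^\sigma_d(x,y,t)\\ &=\sup_{f(x)\le1,\;f(y)=1,\;t\in[0,1]}H^\sigma_d(x,y,t) =\sup_{f(x)\le1,\;f(y)\le1,\;t\in[0,1]}H^\sigma_d(x,y,t), \end{align*} where the suprema are over $x,y\in X$ and $t$ satisfying the indicated constraints.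
   Context: The metric $d$ is an arbitrary metric on $X$ (not assumed translation-invariant; no continuity of the vector space operations is assumed). With $f^\sigma(x):=(f(x))^\sigma$, the von Neumann-Jordan constant of order $\sigma$ associated with $d$ is $$C_{\mathrm{NJ}}^{(\sigma)}(d):=\sup_{(x,y)\ne(0_X,0_X)}\frac{f^\sigma(x+y)+f^\sigma(x-y)}{2^{\sigma-1}(f^\sigma(x)+f^\sigma(y))}\in(0,\infty],$$ the supremum being over $(x,y)\in X\times X$. All suprema are taken in the extended reals. The function $f$ is absolutely homogeneous if $f(\lambda x)=|\lambda|f(x)$ for all $x\in X$ and $\lambda\in\mathbb{R}$. *)

theory Defs
  imports "HOL-Analysis.Analysis"
begin

definition dist_zero :: "('a::real_vector \<Rightarrow> 'a \<Rightarrow> real) \<Rightarrow> 'a \<Rightarrow> real" where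
  "dist_zero d x = d x 0"

definition absolutely_homogeneous :: "('a::real_vector \<Rightarrow> real) \<Rightarrow> bool" where
  "absolutely_homogeneous f \<longleftrightarrow> (\<forall>x. \<forall>c::real. f (c *\<^sub>R x) = \<bar>c\<bar> * f x)"

text \<open>
  The bases of the real powers below are nonnegative whenever \<open>d\<close> is a metric,
  and \<open>0 powr \<sigma> = 0\<close>, so \<open>powr\<close> is the usual power for \<open>\<sigma> \<ge> 1\<close>.
  The denominators are then positive (with \<open>t \<ge> 0\<close> in \<open>H_NJ\<close>), so each quotient is a real number;
  only the supremum is taken in \<open>ereal\<close>.
\<close>

definition C_NJ :: "real \<Rightarrow> ('a::real_vector \<Rightarrow> 'a \<Rightarrow> real) \<Rightarrow> ereal" where
  "C_NJ \<sigma> d =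
    (SUP (x, y) \<in> {(x, y). (x, y) \<noteq> (0, 0)}.
      ereal ((dist_zero d (x + y) powr \<sigma> + dist_zero d (x - y) powr \<sigma>) /
             (2 powr (\<sigma> - 1) * (dist_zero d x powr \<sigma> + dist_zero d y powr \<sigma>))))"

definition H_NJ :: "real \<Rightarrow> ('a::real_vector \<Rightarrow> 'a \<Rightarrow> real) \<Rightarrow> 'a \<Rightarrow> 'a \<Rightarrow> real \<Rightarrow> real" where
  "H_NJ \<sigma> d x y t =
    (dist_zero d (x + t *\<^sub>R y) powr \<sigma> + dist_zero d (x - t *\<^sub>R y) powr \<sigma>) /
    (2 powr (\<sigma> - 1) * (1 + t powr \<sigma>))"

end

theory Submission
  imports Defs
begin

text \<open>
  By homogeneity the von Neumann-Jordan quotient is symmetric and scale invariant. Hence one may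
  assume \<open>f y \<le> f x\<close> and divide by \<open>f x\<close>; the quotient then becomes a value of \<open>H\<close> at unit vectors
  with \<open>t = f y / f x\<close>. Conversely, on the unit balls the denominator of \<open>H x y t\<close> dominates that of
  the quotient at \<open>(x, t y)\<close>.
\<close>

text \<open>This is the expression under the supremum in \<open>C_NJ\<close>, named so that its
  symmetry and scale invariance can be stated and used as rewriting rules.\<close>

definition nj_quotient :: "real \<Rightarrow> ('a::real_vector \<Rightarrow> 'a \<Rightarrow> real) \<Rightarrow> 'a \<Rightarrow> 'a \<Rightarrow> real" where
  "nj_quotient \<sigma> d x y =
    (dist_zero d (x + y) powr \<sigma> + dist_zero d (x - y) powr \<sigma>) /
    (2 powr (\<sigma> - 1) * (dist_zero d x powr \<sigma> + dist_zero d y powr \<sigma>))"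

locale homogeneous_metric =
  fixes d :: "'a::real_vector \<Rightarrow> 'a \<Rightarrow> real" and \<sigma> :: real
  assumes metric: "Metric_space UNIV d"
    and homogeneous: "absolutely_homogeneous (dist_zero d)"
begin

abbreviation f :: "'a \<Rightarrow> real" where "f \<equiv> dist_zero d"

lemma f_nonneg [simp]: "0 \<le> f x"
  using metric by (simp add: dist_zero_def Metric_space.nonneg)

lemma f_eq_0_iff [simp]: "f x = 0 \<longleftrightarrow> x = 0"
  using Metric_space.zero[OF metric, of x 0] by (simp add: dist_zero_def)

lemma f_zero [simp]: "f 0 = 0"
  by simp

lemma f_pos_iff [simp]: "0 < f x \<longleftrightarrow> x \<noteq> 0"
  using f_nonneg[of x] f_eq_0_iff[of x] by linarith

lemma f_scaleR: "f (c *\<^sub>R x) = \<bar>c\<bar> * f x"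
  using homogeneous by (simp add: absolutely_homogeneous_def)

lemma f_minus_commute: "f (x - y) = f (y - x)"
  using f_scaleR[of "-1" "y - x"] by simp

lemma nj_quotient_commute: "nj_quotient \<sigma> d x y = nj_quotient \<sigma> d y x"
  by (simp add: nj_quotient_def f_minus_commute[of x y] add.commute)

lemma nj_quotient_nonneg: "0 \<le> nj_quotient \<sigma> d x y"
  by (simp add: nj_quotient_def)

text \<open>Numerator and denominator both pick up the factor
  \<open>\<bar>c\<bar> powr \<sigma>\<close>, which cancels because it is nonzero.\<close>

lemma nj_quotient_scaleR:
  assumes "c \<noteq> 0"
  shows "nj_quotient \<sigma> d (c *\<^sub>R x) (c *\<^sub>R y) = nj_quotient \<sigma> d x y"
proof -
  have scale: "f (c *\<^sub>R z) powr \<sigma> = \<bar>c\<bar> powr \<sigma> * f z powr \<sigma>" for z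
    by (simp add: f_scaleR powr_mult)
  have "nj_quotient \<sigma> d (c *\<^sub>R x) (c *\<^sub>R y) =
      (\<bar>c\<bar> powr \<sigma> * (f (x + y) powr \<sigma> + f (x - y) powr \<sigma>)) /
      (\<bar>c\<bar> powr \<sigma> * (2 powr (\<sigma> - 1) * (f x powr \<sigma> + f y powr \<sigma>)))"
    unfolding nj_quotient_def scaleR_add_right[symmetric] scaleR_diff_right[symmetric] scale
    by (simp add: algebra_simps)
  also have "\<dots> = nj_quotient \<sigma> d x y"
    using assms by (simp add: nj_quotient_def)
  finally show ?thesis .
qed

text \<open>For unit vectors, homogeneity gives \<open>f (t *\<^sub>R y) = t\<close>, so the two
  denominators coincide.\<close>

lemma H_NJ_unit:
  assumes "f x = 1" "f y = 1" "0 \<le> t"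
  shows "H_NJ \<sigma> d x y t = nj_quotient \<sigma> d x (t *\<^sub>R y)"
  using assms by (simp add: H_NJ_def nj_quotient_def f_scaleR)

lemma nj_quotient_eq_H_NJ:
  assumes "x \<noteq> 0" "f y \<le> f x"
  obtains u v t where "f u = 1" "f v = 1" "t \<in> {0..1}" "nj_quotient \<sigma> d x y = H_NJ \<sigma> d u v t"
proof -
  define u where "u = (1 / f x) *\<^sub>R x"
  \<comment> \<open>If \<open>y = 0\<close> there is no direction to normalise; then
    \<open>t = 0\<close>, so any unit vector serves, and \<open>u\<close> is at hand.\<close>
  define v where "v = (if y = 0 then u else (1 / f y) *\<^sub>R y)"
  define t where "t = f y / f x"
  have u: "f u = 1"
    using assms by (simp add: u_def f_scaleR)
  have v: "f v = 1"
    using u by (simp add: v_def f_scaleR)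
  have t: "t \<in> {0..1}"
    using assms by (simp add: t_def divide_le_eq)
  have "t *\<^sub>R v = (1 / f x) *\<^sub>R y"
    by (cases "y = 0") (simp_all add: t_def v_def)
  then have "H_NJ \<sigma> d u v t = nj_quotient \<sigma> d ((1 / f x) *\<^sub>R x) ((1 / f x) *\<^sub>R y)"
    using H_NJ_unit[OF u v] t by (simp add: u_def)
  also have "\<dots> = nj_quotient \<sigma> d x y"
    using assms by (intro nj_quotient_scaleR) simp
  finally show ?thesis
    using that[OF u v t] by simp
qed

text \<open>The numerators agree, so only the denominators are compared: powers of values in the
  unit interval stay at most 1.\<close>

lemma H_NJ_le_nj_quotient:
  assumes "0 \<le> \<sigma>" "f x \<le> 1" "f y \<le> 1" "0 \<le> t" "(x, t *\<^sub>R y) \<noteq> (0, 0)"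
  shows "H_NJ \<sigma> d x y t \<le> nj_quotient \<sigma> d x (t *\<^sub>R y)"
proof -
  have pow_le: "f z powr \<sigma> \<le> 1" if "f z \<le> 1" for z
    using powr_mono2[OF assms(1) _ that] by simp
  have "f (t *\<^sub>R y) powr \<sigma> = t powr \<sigma> * f y powr \<sigma>"
    using assms by (simp add: f_scaleR powr_mult)
  also have "\<dots> \<le> t powr \<sigma>"
    using pow_le[OF assms(3)] by (simp add: mult_left_le)
  finally have "f x powr \<sigma> + f (t *\<^sub>R y) powr \<sigma> \<le> 1 + t powr \<sigma>"
    using pow_le[OF assms(2)] by simp
  moreover have "0 < f x powr \<sigma> + f (t *\<^sub>R y) powr \<sigma>"
    \<comment> \<open>The smaller denominator must be positive for the division step. Keeping
      \<open>t *\<^sub>R y\<close> as a single vector lets positivity be read off from whichever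
      component is nonzero.\<close>
    using assms(5) by (auto simp: add_pos_nonneg add_nonneg_pos simp del: scaleR_eq_0_iff)
  ultimately show ?thesis
    unfolding H_NJ_def nj_quotient_def by (intro divide_left_mono) (auto simp: add_pos_nonneg)
qed

lemma nj_quotient_le_C_NJ:
  assumes "(x, y) \<noteq> (0, 0)"
  shows "ereal (nj_quotient \<sigma> d x y) \<le> C_NJ \<sigma> d"
  unfolding C_NJ_def nj_quotient_def using assms by (intro SUP_upper2[of "(x, y)"]) auto

lemma H_NJ_le_C_NJ:
  assumes "\<exists>z::'a. z \<noteq> 0" "0 \<le> \<sigma>" "f x \<le> 1" "f y \<le> 1" "0 \<le> t"
  shows "ereal (H_NJ \<sigma> d x y t) \<le> C_NJ \<sigma> d"
proof (cases "(x, t *\<^sub>R y) = (0, 0)")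
  \<comment> \<open>The pair of zeros is excluded from the supremum in \<open>C_NJ\<close>. There
    \<open>H_NJ\<close> vanishes, so any admissible quotient bounds it; nontriviality supplies the
    pair \<open>(z, 0)\<close>.\<close>
  case True
  obtain z :: 'a where "z \<noteq> 0"
    using assms(1) by blast
  have "H_NJ \<sigma> d x y t = 0"
    using True by (auto simp: H_NJ_def)
  then have "ereal (H_NJ \<sigma> d x y t) \<le> ereal (nj_quotient \<sigma> d z 0)"
    by (simp add: nj_quotient_nonneg)
  also have "\<dots> \<le> C_NJ \<sigma> d"
    using \<open>z \<noteq> 0\<close> by (intro nj_quotient_le_C_NJ) simp
  finally show ?thesis .
next
  case False
  then have "ereal (H_NJ \<sigma> d x y t) \<le> ereal (nj_quotient \<sigma> d x (t *\<^sub>R y))"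
    using assms by (simp add: H_NJ_le_nj_quotient)
  also have "\<dots> \<le> C_NJ \<sigma> d"
    using False by (rule nj_quotient_le_C_NJ)
  finally show ?thesis .
qed

lemma C_NJ_le_SUP_H_NJ_unit:
  "C_NJ \<sigma> d \<le>
    (SUP (x, y, t) \<in> {(x, y, t). f x = 1 \<and> f y = 1 \<and> t \<in> {0..1}}. ereal (H_NJ \<sigma> d x y t))"
    (is "_ \<le> ?S")
proof -
  \<comment> \<open>This is the ordered case, where the ratio \<open>f y / f x\<close> lies in the
    unit interval; the other order follows by swapping the arguments.\<close>
  have *: "ereal (nj_quotient \<sigma> d x y) \<le> ?S" if "x \<noteq> 0" "f y \<le> f x" for x y
  proof -
    obtain u v t where "f u = 1" "f v = 1" "t \<in> {0..1}" "nj_quotient \<sigma> d x y = H_NJ \<sigma> d u v t"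
      using \<open>x \<noteq> 0\<close> \<open>f y \<le> f x\<close> by (rule nj_quotient_eq_H_NJ)
    then show ?thesis
      by (intro SUP_upper2[of "(u, v, t)"]) auto
  qed
  have "ereal (nj_quotient \<sigma> d x y) \<le> ?S" if "(x, y) \<noteq> (0, 0)" for x y
  proof (cases "f y \<le> f x")
    case True
    then have "x \<noteq> 0"
      \<comment> \<open>If \<open>x\<close> were zero, then \<open>f y \<le> 0\<close> would force
        \<open>y = 0\<close> as well.\<close>
      using that by (auto simp flip: not_less)
    then show ?thesis
      using True by (rule *)
  next
    case False
    then have "y \<noteq> 0"
      by auto
    then show ?thesis
      using False *[of y x] by (simp add: nj_quotient_commute[of x y])
  qed
  then show ?thesis
    unfolding C_NJ_def nj_quotient_def[symmetric] by (intro SUP_least) auto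
qed

end

theorem proposition3:
  fixes d :: "'a::real_vector \<Rightarrow> 'a \<Rightarrow> real" and \<sigma> :: real
  assumes metric: "Metric_space UNIV d"
    and nontrivial: "\<exists>x::'a. x \<noteq> 0"
    and sigma: "1 \<le> \<sigma>"
    and homogeneous: "absolutely_homogeneous (dist_zero d)"
  shows
    "C_NJ \<sigma> d =
       (SUP (x, y, t) \<in> {(x, y, t). dist_zero d x = 1 \<and> dist_zero d y = 1 \<and> t \<in> {0..1}}.
          ereal (H_NJ \<sigma> d x y t)) \<and>
     (SUP (x, y, t) \<in> {(x, y, t). dist_zero d x = 1 \<and> dist_zero d y = 1 \<and> t \<in> {0..1}}.
          ereal (H_NJ \<sigma> d x y t)) =
       (SUP (x, y, t) \<in> {(x, y, t). dist_zero d x = 1 \<and> dist_zero d y \<le> 1 \<and> t \<in> {0..1}}.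
          ereal (H_NJ \<sigma> d x y t)) \<and>
     (SUP (x, y, t) \<in> {(x, y, t). dist_zero d x = 1 \<and> dist_zero d y \<le> 1 \<and> t \<in> {0..1}}.
          ereal (H_NJ \<sigma> d x y t)) =
       (SUP (x, y, t) \<in> {(x, y, t). dist_zero d x \<le> 1 \<and> dist_zero d y = 1 \<and> t \<in> {0..1}}.
          ereal (H_NJ \<sigma> d x y t)) \<and>
     (SUP (x, y, t) \<in> {(x, y, t). dist_zero d x \<le> 1 \<and> dist_zero d y = 1 \<and> t \<in> {0..1}}.
          ereal (H_NJ \<sigma> d x y t)) =
       (SUP (x, y, t) \<in> {(x, y, t). dist_zero d x \<le> 1 \<and> dist_zero d y \<le> 1 \<and> t \<in> {0..1}}.
          ereal (H_NJ \<sigma> d x y t))"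
    (is "_ = ?S11 \<and> _ = ?S1b \<and> _ = ?Sb1 \<and> _ = ?Sbb")
proof -
  interpret homogeneous_metric d \<sigma>
    using metric homogeneous by (rule homogeneous_metric.intro)
  have "C_NJ \<sigma> d \<le> ?S11"
    by (rule C_NJ_le_SUP_H_NJ_unit)
  \<comment> \<open>Enlarging the index set gives two chains from \<open>?S11\<close> to
    \<open>?Sbb\<close>, one through each mixed supremum. With
    \<open>?Sbb \<le> C_NJ \<sigma> d\<close> both chains close into cycles, so all five values are
    equal.\<close>
  moreover have "?S11 \<le> ?S1b" "?S11 \<le> ?Sb1" "?S1b \<le> ?Sbb" "?Sb1 \<le> ?Sbb"
    by (intro SUP_subset_mono; auto)+
  moreover have "?Sbb \<le> C_NJ \<sigma> d"
    using nontrivial sigma by (intro SUP_least) (auto intro: H_NJ_le_C_NJ)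
  ultimately show ?thesis
    by auto
qed

end
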